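(* Let $p, q$ be distinct propositional variables. Then $$\mathbf{IL}^-(\mathbf{J1}, \mathbf{J5}) \nvdash \boxdot(p \leftrightarrow (\top \rhd \neg p)) \land \boxdot(q \leftrightarrow (\top \rhd \neg q)) \to (p \leftrightarrow q).$$
   Context: Formulas are generated by $A ::= \bot \mid p \mid A \to A \mid \Box A \mid A \rhd A$, where $p$ ranges over a countably infinite set of propositional variables. The symbols $\neg,\land,\lor,\leftrightarrow,\top,\Diamond$ (with $\Diamond A := \neg\Box\neg A$) are the usual abbreviations, and $\boxdot A := A \land \Box A$. $\neg,\Box,\Diamond,\boxdot$ bind most strongly. The logic $\mathbf{IL}^-$ has as axioms all instances of: $\mathbf{L1}$: all tautologies in this language; $\mathbf{L2}$: $\Box(A\to B)\to(\Box A\to\Box B)$; $\mathbf{L3}$: $\Box(\Box A\to A)\to\Box A$; $\mathbf{J3}$: $((A\rhd C)\land(B\rhd C))\to((A\lor B)\rhd C)$; $\mathbf{J6}$: $\Box A\leftrightarrow((\neg A)\rhd\bot)$. Its inference rules are Modus Ponens, Necessitation (from $A$ infer $\Box A$), $\mathbf{R1}$ (from $A\to B$ infer $(C\rhd A)\to(C\rhd B)$) and $\mathbf{R2}$ (from $A\to B$ infer $(B\rhd C)\to(A\rhd C)$). $\mathbf{IL}^-(\Sigma_1,\ldots,\Sigma_n)$ is the logic obtained from $\mathbf{IL}^-$ by adding the schemata $\Sigma_1,\ldots,\Sigma_n$ as axiom schemata (with the same rules). $\mathbf{J1}$ is the schema $\Box(A\to B)\to(A\rhd B)$ and $\mathbf{J5}$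 is the schema $\Diamond A\rhd A$. $L \nvdash A$ means that $A$ is not a theorem of $L$. *)

theory Defs
  imports Main
begin

datatype fm =
    Bot ("\<^bold>\<bottom>")
  | Var nat
  | Imp fm fm (infixr "\<^bold>\<rightarrow>" 55)
  | Box fm ("\<^bold>\<box> _" [80] 80)
  | Rhd fm fm (infix "\<^bold>\<rhd>" 70)

abbreviation Neg :: "fm \<Rightarrow> fm" ("\<^bold>\<not> _" [80] 80)
  where "\<^bold>\<not> A \<equiv> A \<^bold>\<rightarrow> \<^bold>\<bottom>"

abbreviation Top :: fm ("\<^bold>\<top>")
  where "\<^bold>\<top> \<equiv> \<^bold>\<not> \<^bold>\<bottom>"

abbreviation Or :: "fm \<Rightarrow> fm \<Rightarrow> fm" (infixr "\<^bold>\<or>" 60)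
  where "A \<^bold>\<or> B \<equiv> \<^bold>\<not> A \<^bold>\<rightarrow> B"

abbreviation And :: "fm \<Rightarrow> fm \<Rightarrow> fm" (infixr "\<^bold>\<and>" 65)
  where "A \<^bold>\<and> B \<equiv> \<^bold>\<not> (A \<^bold>\<rightarrow> \<^bold>\<not> B)"

abbreviation Iff :: "fm \<Rightarrow> fm \<Rightarrow> fm" (infix "\<^bold>\<leftrightarrow>" 53)
  where "A \<^bold>\<leftrightarrow> B \<equiv> (A \<^bold>\<rightarrow> B) \<^bold>\<and> (B \<^bold>\<rightarrow> A)"

abbreviation Dia :: "fm \<Rightarrow> fm" ("\<^bold>\<diamond> _" [80] 80)
  where "\<^bold>\<diamond> A \<equiv> \<^bold>\<not> \<^bold>\<box> \<^bold>\<not> A"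

abbreviation Boxdot :: "fm \<Rightarrow> fm" ("\<^bold>\<odot> _" [80] 80)
  where "\<^bold>\<odot> A \<equiv> A \<^bold>\<and> \<^bold>\<box> A"

text \<open>A tautology in the modal language is a formula that is true under every Boolean
  valuation in which the modal formulas \<open>\<^bold>\<box> A\<close> and \<open>A \<^bold>\<rhd> B\<close>, like the variables, count as atoms;
  the values of \<open>v\<close> on the other formulas are irrelevant.\<close>

primrec tval :: "(fm \<Rightarrow> bool) \<Rightarrow> fm \<Rightarrow> bool" where
  "tval v \<^bold>\<bottom> = False"
| "tval v (Var p) = v (Var p)"
| "tval v (A \<^bold>\<rightarrow> B) = (tval v A \<longrightarrow> tval v B)"
| "tval v (\<^bold>\<box> A) = v (\<^bold>\<box> A)"
| "tval v (A \<^bold>\<rhd> B) = v (A \<^bold>\<rhd> B)"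

definition tautology :: "fm \<Rightarrow> bool" where
  "tautology A \<longleftrightarrow> (\<forall>v. tval v A)"

text \<open>A schema is represented by the set of its instances, so that adding several schemata to
  the base logic amounts to adding their union.\<close>

inductive ILm :: "fm set \<Rightarrow> fm \<Rightarrow> bool" for \<Sigma> :: "fm set" where
  L1: "tautology A \<Longrightarrow> ILm \<Sigma> A"
| L2: "ILm \<Sigma> (\<^bold>\<box> (A \<^bold>\<rightarrow> B) \<^bold>\<rightarrow> (\<^bold>\<box> A \<^bold>\<rightarrow> \<^bold>\<box> B))"
| L3: "ILm \<Sigma> (\<^bold>\<box> (\<^bold>\<box> A \<^bold>\<rightarrow> A) \<^bold>\<rightarrow> \<^bold>\<box> A)"
| J3: "ILm \<Sigma> ((A \<^bold>\<rhd> C) \<^bold>\<and> (B \<^bold>\<rhd> C) \<^bold>\<rightarrow> (A \<^bold>\<or> B) \<^bold>\<rhd> C)"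
| J6: "ILm \<Sigma> (\<^bold>\<box> A \<^bold>\<leftrightarrow> (\<^bold>\<not> A) \<^bold>\<rhd> \<^bold>\<bottom>)"
| Added: "A \<in> \<Sigma> \<Longrightarrow> ILm \<Sigma> A"
| MP: "ILm \<Sigma> (A \<^bold>\<rightarrow> B) \<Longrightarrow> ILm \<Sigma> A \<Longrightarrow> ILm \<Sigma> B"
| Nec: "ILm \<Sigma> A \<Longrightarrow> ILm \<Sigma> (\<^bold>\<box> A)"
| R1: "ILm \<Sigma> (A \<^bold>\<rightarrow> B) \<Longrightarrow> ILm \<Sigma> ((C \<^bold>\<rhd> A) \<^bold>\<rightarrow> (C \<^bold>\<rhd> B))"
| R2: "ILm \<Sigma> (A \<^bold>\<rightarrow> B) \<Longrightarrow> ILm \<Sigma> ((B \<^bold>\<rhd> C) \<^bold>\<rightarrow> (A \<^bold>\<rhd> C))"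

definition J1 :: "fm set" where
  "J1 = {\<^bold>\<box> (A \<^bold>\<rightarrow> B) \<^bold>\<rightarrow> (A \<^bold>\<rhd> B) | A B. True}"

definition J5 :: "fm set" where
  "J5 = {\<^bold>\<diamond> A \<^bold>\<rhd> A | A. True}"

end

(* In a Veltman model the targets of the relation S x need not be successors of x unless J4 is
   required. Boxdot at w only constrains w and its successors, so take w with a single successor y,
   which is terminal, and a third point z with y S_w z where p fails and q holds. Both variables are
   forced at y, and at w the fixed point equations then make p true (witness z) and q false. *)

theory Submission
  imports Defs
begin

primrec forces ::
  "('w \<Rightarrow> 'w \<Rightarrow> bool) \<Rightarrow> ('w \<Rightarrow> 'w \<Rightarrow> 'w \<Rightarrow> bool) \<Rightarrow> ('w \<Rightarrow> nat \<Rightarrow> bool) \<Rightarrow> fm \<Rightarrow> 'w \<Rightarrow> bool"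
  where
  "forces R S V \<^bold>\<bottom> x \<longleftrightarrow> False"
| "forces R S V (Var p) x \<longleftrightarrow> V x p"
| "forces R S V (A \<^bold>\<rightarrow> B) x \<longleftrightarrow> (forces R S V A x \<longrightarrow> forces R S V B x)"
| "forces R S V (\<^bold>\<box> A) x \<longleftrightarrow> (\<forall>y. R x y \<longrightarrow> forces R S V A y)"
| "forces R S V (A \<^bold>\<rhd> B) x \<longleftrightarrow>
    (\<forall>y. R x y \<longrightarrow> forces R S V A y \<longrightarrow> (\<exists>z. S x y z \<and> forces R S V B z))"

text \<open>Forcing at a fixed world is a Boolean valuation with modal formulas as atoms, which
  settles \<open>L1\<close>.\<close>

lemma tval_forces: "tval (\<lambda>B. forces R S V B x) A \<longleftrightarrow> forces R S V A x"
  by (induction A) simp_all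

text \<open>Semantic core of \<open>L3\<close>: induction along the converse of \<open>R\<close>.
  Transitivity keeps successors of \<open>y\<close> among those of \<open>x\<close>, so the
  induction hypothesis reaches them.\<close>

lemma Loeb_induct:
  assumes "transp R" and "wfP R\<inverse>\<inverse>"
    and step: "\<And>y. R x y \<Longrightarrow> (\<And>z. R y z \<Longrightarrow> P z) \<Longrightarrow> P y"
    and "R x y"
  shows "P y"
  using \<open>wfP R\<inverse>\<inverse>\<close> \<open>R x y\<close>
proof (induction y rule: wfp_induct_rule)
  case (less y)
  show ?case
  proof (rule step[OF less.prems])
    fix z
    assume "R y z"
    then show "P z"
      using less transpD[OF \<open>transp R\<close> less.prems] by simp
  qed
qed

text \<open>\<open>S_refl\<close> yields \<open>J1\<close> with \<open>y\<close> as its own witness;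
  \<open>S_R\<close> yields \<open>J5\<close>, a successor of \<open>y\<close> forcing
  \<open>A\<close> being the witness.\<close>

theorem ILm_J1_J5_sound:
  assumes "ILm (J1 \<union> J5) A"
    and trans: "transp R" and cwf: "wfP R\<inverse>\<inverse>"
    and S_refl: "\<And>x y. R x y \<Longrightarrow> S x y y"
    and S_R: "\<And>x y z. R x y \<Longrightarrow> R y z \<Longrightarrow> S x y z"
  shows "forces R S V A x"
  using assms(1)
proof (induction A arbitrary: x)
  case (L1 A)
  then show ?case
    using tval_forces[of R S V x A] unfolding tautology_def by blast
next
  case (L3 A)
  show ?case
    using Loeb_induct[OF trans cwf, of x "forces R S V A"] by simp
next
  case (Added A)
  then show ?case
  proof
    assume "A \<in> J1"
    then show ?case
      unfolding J1_def using S_refl by (clarsimp; blast)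
  next
    assume "A \<in> J5"
    then show ?case
      unfolding J5_def using S_R by (clarsimp; blast)
  qed
next
  case (R1 A B C)
  from R1.IH have "forces R S V A z \<longrightarrow> forces R S V B z" for z by simp
  then show ?case by (simp only: forces.simps) blast
next
  case (R2 A B C)
  from R2.IH have "forces R S V A z \<longrightarrow> forces R S V B z" for z by simp
  then show ?case by (simp only: forces.simps) blast
next
  case (MP A B)
  from MP.IH show ?case by simp
next
  case (Nec A)
  then show ?case by simp
\<comment> \<open>Left are \<open>L2\<close>, \<open>J3\<close> and \<open>J6\<close>; the last
  holds because no world forces \<open>Bot\<close>.\<close>
qed (simp only: forces.simps, blast)+

theorem proposition3p4:
  fixes p q :: nat
  assumes "p \<noteq> q"
  shows "\<not> ILm (J1 \<union> J5)
    (\<^bold>\<odot> (Var p \<^bold>\<leftrightarrow> (\<^bold>\<top> \<^bold>\<rhd> \<^bold>\<not> Var p)) \<^bold>\<and> \<^bold>\<odot> (Var q \<^bold>\<leftrightarrow> (\<^bold>\<top> \<^bold>\<rhd> \<^bold>\<not> Var q))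
      \<^bold>\<rightarrow> (Var p \<^bold>\<leftrightarrow> Var q))" (is "\<not> ILm _ ?F")
proof
  assume der: "ILm (J1 \<union> J5) ?F"
  define R :: "nat \<Rightarrow> nat \<Rightarrow> bool" where "R = (\<lambda>x y. x = 0 \<and> y = 1)"
  define S :: "nat \<Rightarrow> nat \<Rightarrow> nat \<Rightarrow> bool"
    \<comment> \<open>Target 1 secures \<open>S_refl\<close>; target 2 is the extra point outside
      the range of \<open>R\<close>. \<open>S_R\<close> is vacuous since 1 is terminal.\<close>
    where "S = (\<lambda>x y z. x = 0 \<and> y = 1 \<and> (z = 1 \<or> z = 2))"
  define V :: "nat \<Rightarrow> nat \<Rightarrow> bool"
    \<comment> \<open>At 1 both variables hold, as \<open>\<rhd>\<close>-formulas hold vacuously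
      there. At 0, world 2 refutes \<open>p\<close>, but neither 1 nor 2 refutes
      \<open>q\<close>.\<close>
    where "V = (\<lambda>x r. if x = 0 then r = p else if x = 1 then True else r = q)"
  have "transp R"
    by (auto simp: R_def transp_def)
  moreover have "wfP R\<inverse>\<inverse>"
    unfolding wfp_def
    by (rule wf_subset[OF wf_measure[of "\<lambda>x. 1 - x"]]) (auto simp: R_def)
  ultimately have "forces R S V ?F 0"
    by (rule ILm_J1_J5_sound[OF der]) (auto simp: R_def S_def)
  then show False
    using assms by (auto simp: R_def S_def V_def)
qed

end
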